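(* Assume $\alpha>\beta+1$, $\beta\ge0$, $\theta>0$, and let $f(u)=u$. For $\rho>0$ let $u(\cdot,\rho)$ be the solution on $[0,\infty)$ of $L(u)+e^{u}=0$, $u(0)=\rho$, $u'(0)=0$, let $R(0,\rho)$ be its unique positive zero, $\lambda(\rho)=R(0,\rho)^\theta$ and $u_{\lambda(\rho)}(r)=u(\lambda(\rho)^{1/\theta}r,\rho)$. Let $u^*(r)=\ln\{\theta^{\beta+1}(\alpha-\beta-1)\}-\theta\ln r$, $\lambda^*=\theta^{\beta+1}(\alpha-\beta-1)$, $u^*_{\lambda^*}(r)=-\theta\ln r$. Then, as $\rho\to+\infty$, $u(\cdot,\rho)\to u^*$ uniformly on compact subsets of $(0,\infty)$, $\lambda(\rho)\to\lambda^*$, and $u_{\lambda(\rho)}\to u^*_{\lambda^*}$ uniformly on compact subsets of $(0,\infty)$.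
   Context: $L(u)(r)=r^{-\gamma}(r^{\alpha}|u'(r)|^{\beta}u'(r))'$ and $\theta=\gamma+2+\beta-\alpha$. $(u_{\lambda(\rho)},\lambda(\rho))$ is the regular solution of $L(u)+\lambda e^u=0$ on $[0,1]$, $u'(0)=u(1)=0$, with $u(0)=\rho$; $u^*$ and $u^*_{\lambda^*}$ are the singular solutions of $L(u)+e^u=0$ and of $L(u)+\lambda^*e^u=0$, $u(1)=0$, respectively. *)

theory Defs
  imports "HOL-Analysis.Analysis"
begin

text \<open>Flux of the operator L: r^alpha |v'(r)|^beta v'(r).  Note |x| powr beta * x = 0
  for x = 0 regardless of the convention for 0 powr 0.\<close>
definition flux :: "real \<Rightarrow> real \<Rightarrow> real \<Rightarrow> real \<Rightarrow> real" where
  "flux \<alpha> \<beta> r d = r powr \<alpha> * (\<bar>d\<bar> powr \<beta> * d)"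

definition is_regular_sol :: "real \<Rightarrow> real \<Rightarrow> real \<Rightarrow> real \<Rightarrow> (real \<Rightarrow> real) \<Rightarrow> bool" where
  "is_regular_sol \<alpha> \<beta> \<gamma> \<rho> v \<longleftrightarrow>
     (\<exists>v'. (\<forall>r\<ge>0. (v has_real_derivative v' r) (at r within {0..}))
        \<and> continuous_on {0..} v'
        \<and> v 0 = \<rho> \<and> v' 0 = 0
        \<and> (\<forall>r>0. ((\<lambda>s. flux \<alpha> \<beta> s (v' s)) has_real_derivative
                     (- (r powr \<gamma>) * exp (v r))) (at r)))"

end

(* With t = ln r, y = u + theta t, a = alpha - beta - 1, k = 1/(beta+1) and
   q = (-r u')^(beta+1), the equation becomes the autonomous system
     y' = theta - q^k,   q' = exp y - a q,
   whose only equilibrium has qs = theta^(beta+1) and exp y = a qs. With x = y - ln (a qs), the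
   function V = a qs (exp x - 1 - x) + (integral of s^k - qs^k from qs to q) satisfies
   V' = -a (q^k - qs^k)(q - qs) <= 0, and V - e x (q - qs) is strictly dissipative for small e > 0.
   Hence V <= C / (t - t0), where C depends only on a bound for V at t0. At t0 = -rho/theta such a
   bound holds uniformly in rho, so y is close to ln (a qs) for all t >= t0 + T, with T independent
   of rho; no uniqueness or scaling of regular solutions is needed. Since t0 tends to minus
   infinity, the convergence is uniform on every half-line r >= c > 0, and evaluating at the zero
   R(rho) gives the limit of R(rho)^theta. *)
theory Submission
  imports Defs
begin

section \<open>Convex potential of the flux variable\<close>

text \<open>The primitive of \<open>s powr k - qs powr k\<close> that vanishes at \<open>qs\<close>.\<close>
definition pot :: "real \<Rightarrow> real \<Rightarrow> real \<Rightarrow> real" where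
  "pot k qs q = q powr (k + 1) / (k + 1) - qs powr k * q
     - (qs powr (k + 1) / (k + 1) - qs powr k * qs)"

lemma pot_deriv:
  assumes "q > 0" "k > 0"
  shows "(pot k qs has_real_derivative (q powr k - qs powr k)) (at q)"
proof -
  have "((\<lambda>q. q powr (k + 1)) has_real_derivative (k + 1) * q powr k) (at q)"
    using has_real_derivative_powr[OF assms(1), of "k + 1"] by simp
  then have "((\<lambda>q. q powr (k + 1) / (k + 1)) has_real_derivative q powr k) (at q)"
    using assms(2) by (auto dest: DERIV_cdivide[where c = "k + 1"])
  from DERIV_diff[OF DERIV_diff[OF this DERIV_cmult[OF DERIV_ident]] DERIV_const]
  show ?thesis unfolding pot_def by simp
qed

lemma pot_mvt:
  assumes "k > 0" "0 < p" "p < q"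
  obtains \<xi> where "p < \<xi>" "\<xi> < q"
    "pot k qs q - pot k qs p = (q - p) * (\<xi> powr k - qs powr k)"
proof -
  have "\<exists>\<xi>. \<xi> > p \<and> \<xi> < q \<and>
      pot k qs q - pot k qs p = (q - p) * (\<xi> powr k - qs powr k)"
    using assms by (intro MVT2) (auto intro!: pot_deriv)
  with that show ?thesis by blast
qed

text \<open>The derivative \<open>s powr k - qs powr k\<close> is increasing and vanishes at
  \<open>qs\<close>, so \<open>qs\<close> is the minimum, and the mean slope between
  \<open>qs\<close> and \<open>q\<close> is dominated by the slope at \<open>q\<close>. The upper
  bound lets the dissipation of the system control the potential.\<close>

lemma pot_bounds:
  assumes "k > 0" "qs > 0" "q > 0"
  shows "0 \<le> pot k qs q" "pot k qs q \<le> (q powr k - qs powr k) * (q - qs)"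
proof -
  have z: "pot k qs qs = 0" by (simp add: pot_def)
  consider "q = qs" | "qs < q" | "q < qs" by linarith
  then have "0 \<le> pot k qs q \<and> pot k qs q \<le> (q powr k - qs powr k) * (q - qs)"
  proof cases
    case 1
    then show ?thesis using z by simp
  next
    case 2
    obtain \<xi> where x: "qs < \<xi>" "\<xi> < q"
      "pot k qs q - pot k qs qs = (q - qs) * (\<xi> powr k - qs powr k)"
      using pot_mvt[OF assms(1,2) 2] .
    have "qs powr k \<le> \<xi> powr k" "\<xi> powr k \<le> q powr k"
      using x assms by (auto intro!: powr_mono2)
    then show ?thesis using x z 2
      by (auto simp: mult.commute intro!: mult_left_mono)
  next
    case 3
    obtain \<xi> where x: "q < \<xi>" "\<xi> < qs"
      "pot k qs qs - pot k qs q = (qs - q) * (\<xi> powr k - qs powr k)"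
      using pot_mvt[OF assms(1,3) 3] .
    have le: "q powr k \<le> \<xi> powr k" "\<xi> powr k \<le> qs powr k"
      using x assms by (auto intro!: powr_mono2)
    have e: "pot k qs q = (qs - q) * (qs powr k - \<xi> powr k)"
      using x(3) z by (simp add: algebra_simps)
    have "(qs - q) * (qs powr k - \<xi> powr k) \<le> (qs - q) * (qs powr k - q powr k)"
      using le 3 by (intro mult_left_mono) auto
    moreover have "0 \<le> (qs - q) * (qs powr k - \<xi> powr k)"
      using le 3 by simp
    ultimately show ?thesis unfolding e by (simp add: algebra_simps)
  qed
  then show "0 \<le> pot k qs q" "pot k qs q \<le> (q powr k - qs powr k) * (q - qs)"
    by auto
qed

text \<open>Beyond the point \<open>q1\<close> where \<open>q1 powr k = 2 * qs powr k\<close> the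
  slope is at least \<open>qs powr k\<close>, so the potential grows at least linearly
  there.\<close>

lemma pot_coercive:
  assumes "k > 0" "qs > 0" "q > 0" "pot k qs q \<le> C"
  shows "q \<le> 2 powr (1 / k) * qs + C / qs powr k"
proof -
  define q1 where "q1 = 2 powr (1 / k) * qs"
  have C: "C \<ge> 0" using pot_bounds(1)[OF assms(1-3)] assms(4) by linarith
  have q1: "q1 > 0" "q1 powr k = 2 * qs powr k"
    using assms by (auto simp: q1_def powr_mult powr_powr)
  show ?thesis
  proof (cases "q \<le> q1")
    case True
    have "0 \<le> C / qs powr k" using C by simp
    then show ?thesis using True by (simp add: q1_def)
  next
    case False
    then have "q1 < q" by simp
    obtain \<xi> where x: "q1 < \<xi>" "\<xi> < q"
      "pot k qs q - pot k qs q1 = (q - q1) * (\<xi> powr k - qs powr k)"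
      using pot_mvt[OF assms(1) q1(1) \<open>q1 < q\<close>] .
    have "q1 powr k \<le> \<xi> powr k" using x assms q1(1) by (intro powr_mono2) auto
    then have "(q - q1) * qs powr k \<le> (q - q1) * (\<xi> powr k - qs powr k)"
      using False q1 by (intro mult_left_mono) auto
    also have "\<dots> \<le> C"
      using x(3) pot_bounds(1)[OF assms(1,2) q1(1)] assms(4) by linarith
    finally have "q - q1 \<le> C / qs powr k"
      using assms by (simp add: pos_le_divide_eq)
    then show ?thesis by (simp add: q1_def)
  qed
qed

section \<open>Quadratic lower bounds for powers and the exponential\<close>

text \<open>Because \<open>k \<le> 1\<close>, the derivative \<open>k * z powr (k - 1)\<close> is
  decreasing in \<open>z\<close>, so on \<open>(0, Q]\<close> it is at least its value at
  \<open>Q\<close>; the mean value theorem does the rest. This is where \<beta> \<ge> 0 enters the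
  decay argument.\<close>

lemma powr_strong_mono:
  fixes k :: real
  assumes "0 < k" "k \<le> 1" "0 < p" "p \<le> Q" "0 < q" "q \<le> Q"
  shows "k * Q powr (k - 1) * (q - p)\<^sup>2 \<le> (q powr k - p powr k) * (q - p)"
proof -
  have *: "k * Q powr (k - 1) * (q - p)\<^sup>2 \<le> (q powr k - p powr k) * (q - p)"
    if "0 < p" "p < q" "q \<le> Q" for p q
  proof -
    have "\<exists>z. z > p \<and> z < q \<and> q powr k - p powr k = (q - p) * (k * z powr (k - 1))"
      using that by (intro MVT2) (auto intro!: derivative_eq_intros)
    then obtain z where z: "p < z" "z < q"
      "q powr k - p powr k = (q - p) * (k * z powr (k - 1))" by blast
    have "Q powr (k - 1) \<le> z powr (k - 1)"
      using z that assms by (intro powr_mono2') auto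
    then have "k * Q powr (k - 1) * (q - p)\<^sup>2 \<le> k * z powr (k - 1) * (q - p)\<^sup>2"
      using assms by (intro mult_right_mono mult_left_mono) auto
    then show ?thesis unfolding z(3) by (simp add: power2_eq_square algebra_simps)
  qed
  consider "q = p" | "p < q" | "q < p" by linarith
  then show ?thesis
  proof cases
    case 3
    from *[of q p] 3 assms show ?thesis by (simp add: power2_commute algebra_simps)
  qed (use * assms in auto)
qed

text \<open>Taylor expansion of order 1 and 2 with Lagrange remainder: the intermediate point has
  modulus at most \<open>X\<close>, so its exponential is at least \<open>exp (- X)\<close>.\<close>

lemma exp_lower_bounds:
  fixes x X :: real
  assumes "\<bar>x\<bar> \<le> X"
  shows "exp (- X) * x\<^sup>2 \<le> x * (exp x - 1)"
    and "exp (- X) / 2 * x\<^sup>2 \<le> exp x - 1 - x"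
proof -
  obtain t where t: "\<bar>t\<bar> \<le> \<bar>x\<bar>" "exp x = (\<Sum>m<1. x ^ m / fact m) + exp t / fact 1 * x ^ 1"
    using Maclaurin_exp_le by blast
  have "exp (- X) \<le> exp t" using t assms by simp
  from mult_right_mono[OF this, of "x\<^sup>2"] t(2)
  show "exp (- X) * x\<^sup>2 \<le> x * (exp x - 1)"
    by (simp add: power2_eq_square algebra_simps)
  obtain s where s: "\<bar>s\<bar> \<le> \<bar>x\<bar>" "exp x = (\<Sum>m<2. x ^ m / fact m) + exp s / fact 2 * x ^ 2"
    using Maclaurin_exp_le by blast
  have "exp (- X) \<le> exp s" using s assms by simp
  from mult_right_mono[OF this, of "x\<^sup>2"] s(2)
  show "exp (- X) / 2 * x\<^sup>2 \<le> exp x - 1 - x"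
    by (simp add: numeral_2_eq_2)
qed

text \<open>The second bound is \<open>1 - x \<le> exp (- x)\<close> multiplied by
  \<open>exp x\<close>, the analogue of the upper bound in \<open>pot_bounds\<close>. The third
  converts a bound on the Lyapunov function into one on \<open>x\<close>.\<close>

lemma exp_convex_bounds:
  fixes x :: real
  shows "0 \<le> exp x - 1 - x" "exp x - 1 - x \<le> x * (exp x - 1)" "\<bar>x\<bar> \<le> (exp x - 1 - x) + 1"
proof -
  show "0 \<le> exp x - 1 - x" using exp_ge_add_one_self[of x] by linarith
  have "1 - x \<le> exp (- x)" using exp_ge_add_one_self[of "-x"] by simp
  then have "exp x * (1 - x) \<le> exp x * exp (- x)" by (intro mult_left_mono) auto
  then show "exp x - 1 - x \<le> x * (exp x - 1)"
    by (simp add: exp_minus_inverse algebra_simps)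
  show "\<bar>x\<bar> \<le> (exp x - 1 - x) + 1"
  proof (cases "x \<ge> 0")
    case True
    have "0 \<le> (x - 1)\<^sup>2" by simp
    then have "2 * x \<le> 1 + x + x\<^sup>2 / 2" using True
      by (simp add: power2_eq_square algebra_simps)
    also have "\<dots> \<le> exp x" using exp_lower_Taylor_quadratic[OF True] .
    finally show ?thesis using True by simp
  next
    case False
    then show ?thesis using exp_ge_zero[of x] by (simp add: abs_if)
  qed
qed

section \<open>Lyapunov function and uniform decay\<close>

text \<open>A Hamiltonian with friction: the system is \<open>x' = - dV/dq\<close>,
  \<open>q' = dV/dx - a * (q - qs)\<close> for this function \<open>V\<close>. The Hamiltonian terms
  cancel in its time derivative, and only the friction remains.\<close>

definition lyap :: "real \<Rightarrow> real \<Rightarrow> real \<Rightarrow> real \<Rightarrow> real \<Rightarrow> real" where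
  "lyap k a qs x q = a * qs * (exp x - 1 - x) + pot k qs q"

text \<open>The left-hand side is the time derivative of
  \<open>lyap - e * x * (q - qs)\<close> along the system, plus \<open>e / 2 * lyap\<close>.\<close>
lemma lyap_rate:
  fixes k a qs X Q :: real
  assumes k: "0 < k" "k \<le> 1" and a: "0 < a" and qs: "0 < qs" "qs \<le> Q"
  obtains e where "e > 0" "\<And>x q. \<bar>x\<bar> \<le> X \<Longrightarrow> 0 < q \<Longrightarrow> q \<le> Q \<Longrightarrow>
      - a * (q powr k - qs powr k) * (q - qs)
      + e * ((q powr k - qs powr k) * (q - qs) - x * (a * qs * (exp x - 1)) + a * x * (q - qs))
      + e / 2 * lyap k a qs x q \<le> 0"
proof -
  \<comment> \<open>\<open>l\<close> and \<open>c\<close> are the constants of the quadratic lower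
    bounds for \<open>A\<close> and \<open>B\<close> below. \<open>K\<close> comes from Young's
    inequality \<open>a * x * v \<le> l * x^2 / 2 + K * (c * v^2)\<close>, and \<open>e\<close> is
    fixed by \<open>e * (K + 2) = a\<close>, so that the friction absorbs everything left
    over.\<close>
  define l where "l = a * qs * exp (- X)"
  define c where "c = k * Q powr (k - 1)"
  define K where "K = a\<^sup>2 / (2 * l * c)"
  define e where "e = a / (K + 2)"
  have l: "l > 0" using a qs by (simp add: l_def)
  have c: "c > 0" using k qs by (simp add: c_def)
  have K: "K \<ge> 0" using l c by (simp add: K_def)
  have e: "e > 0" "e * (K + 2) = a" using a K by (auto simp: e_def)
  show thesis
  proof (rule that[OF e(1)])
    fix x q :: real assume x: "\<bar>x\<bar> \<le> X" and q: "0 < q" "q \<le> Q"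
    define A where "A = x * (a * qs * (exp x - 1))"
    define B where "B = (q powr k - qs powr k) * (q - qs)"
    define v where "v = q - qs"
    have A: "l * x\<^sup>2 \<le> A"
      using mult_left_mono[OF exp_lower_bounds(1)[OF x], of "a * qs"] a qs
      by (simp add: A_def l_def algebra_simps)
    have B: "c * v\<^sup>2 \<le> B"
      using powr_strong_mono[OF k qs q] by (simp add: B_def c_def v_def)
    have B0: "0 \<le> B" using B c by (meson mult_nonneg_nonneg order.trans zero_le_power2 less_imp_le)
    have V: "lyap k a qs x q \<le> A + B"
      using mult_left_mono[OF exp_convex_bounds(2)[of x], of "a * qs"] a qs
        pot_bounds(2)[OF k(1) qs(1) q(1)]
      by (simp add: lyap_def A_def B_def algebra_simps)
    have "0 \<le> (l * x - a * v)\<^sup>2" by simp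
    then have "2 * l * (a * x * v) \<le> l * (l * x\<^sup>2) + a\<^sup>2 * v\<^sup>2"
      by (simp add: power2_eq_square algebra_simps)
    then have "a * x * v \<le> (l * (l * x\<^sup>2) + a\<^sup>2 * v\<^sup>2) / (2 * l)"
      using l by (simp add: pos_le_divide_eq algebra_simps)
    also have "\<dots> = l * x\<^sup>2 / 2 + K * (c * v\<^sup>2)"
      using l c by (simp add: K_def field_simps)
    also have "\<dots> \<le> A / 2 + K * B" using A B K by (intro add_mono mult_left_mono) auto
    finally have "B - A + a * x * v + (1/2) * lyap k a qs x q \<le> B - A + (A / 2 + K * B) + (1/2) * (A + B)"
      using V by (intro add_mono) auto
    \<comment> \<open>The coefficients of \<open>A\<close> are -1 + 1/2 + 1/2 = 0, and those of
      \<open>B\<close> add up to \<open>K + 3/2\<close>.\<close>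
    also have "\<dots> \<le> (K + 2) * B" using B0 by (simp add: field_simps)
    finally have "e * (B - A + a * x * v + (1/2) * lyap k a qs x q) \<le> e * ((K + 2) * B)"
      using e by (intro mult_left_mono) auto
    also have "\<dots> = a * B" using e(2) by (simp flip: mult.assoc)
    finally have "- a * B + e * (B - A + a * x * v) + e / 2 * lyap k a qs x q \<le> 0"
      by (simp add: algebra_simps)
    then show "- a * (q powr k - qs powr k) * (q - qs)
      + e * ((q powr k - qs powr k) * (q - qs) - x * (a * qs * (exp x - 1)) + a * x * (q - qs))
      + e / 2 * lyap k a qs x q \<le> 0"
      by (simp add: A_def B_def v_def mult.assoc)
  qed
qed

lemma lyap_deriv:
  assumes "k > 0" "q t > 0"
    and x: "(x has_real_derivative (qs powr k - q t powr k)) (at t)"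
    and q: "(q has_real_derivative (a * qs * exp (x t) - a * q t)) (at t)"
  shows "((\<lambda>t. lyap k a qs (x t) (q t)) has_real_derivative
     - a * (q t powr k - qs powr k) * (q t - qs)) (at t)"
proof -
  have p: "((\<lambda>t. pot k qs (q t)) has_real_derivative
      (q t powr k - qs powr k) * (a * qs * exp (x t) - a * q t)) (at t)"
    using DERIV_chain2[OF pot_deriv q] assms by blast
  show ?thesis unfolding lyap_def
    by (rule derivative_eq_intros x p refl)+ (simp add: algebra_simps)
qed

text \<open>The order of quantifiers matters: \<open>T\<close> is fixed before the trajectory.
  Monotonicity of the Lyapunov function confines the trajectory to a box determined by
  \<open>V0\<close>, and on that box one \<open>e\<close> from \<open>lyap_rate\<close> serves all
  trajectories.\<close>

lemma emden_fowler_uniform_convergence: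
  fixes k a qs V0 \<eta> :: real
  assumes k: "0 < k" "k \<le> 1" and a: "0 < a" and qs: "0 < qs" and \<eta>: "\<eta> > 0"
  obtains T where "T > 0" "\<And>x q t0 t. \<lbrakk>\<And>t. q t > 0;
       \<And>t. (x has_real_derivative (qs powr k - q t powr k)) (at t);
       \<And>t. (q has_real_derivative (a * qs * exp (x t) - a * q t)) (at t);
       lyap k a qs (x t0) (q t0) \<le> V0; t \<ge> t0 + T\<rbrakk> \<Longrightarrow> \<bar>x t\<bar> < \<eta>"
proof -
  \<comment> \<open>The sublevel set at height \<open>V1\<close> lies in the box
    \<open>|x| \<le> X\<close>, \<open>q \<le> Q\<close>, by \<open>exp_convex_bounds\<close> and
    \<open>pot_coercive\<close>. The maximum in \<open>Q\<close> secures \<open>qs \<le> Q\<close>,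
    which \<open>lyap_rate\<close> requires.\<close>
  define V1 where "V1 = max V0 0"
  define X where "X = V1 / (a * qs) + 1"
  define Q where "Q = max qs (2 powr (1 / k) * qs + V1 / qs powr k)"
  obtain e where e: "e > 0" "\<And>x q. \<bar>x\<bar> \<le> X \<Longrightarrow> 0 < q \<Longrightarrow> q \<le> Q \<Longrightarrow>
      - a * (q powr k - qs powr k) * (q - qs)
      + e * ((q powr k - qs powr k) * (q - qs) - x * (a * qs * (exp x - 1)) + a * x * (q - qs))
      + e / 2 * lyap k a qs x q \<le> 0"
    using lyap_rate[OF k a qs, of Q X] by (auto simp: Q_def)
  \<comment> \<open>\<open>V1\<close> bounds the initial value, and \<open>e * (X * Q)\<close>
    bounds the cross term at each of the two endpoints. \<open>l\<close> is such that
    \<open>l * x^2 * (t - t0)\<close> is at most \<open>e / 2 * ((t - t0) * V)\<close>.\<close>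
  define C where "C = V1 + 2 * e * (X * Q)"
  define l where "l = e / 2 * (a * qs * (exp (- X) / 2))"
  have l: "l > 0" using a qs e by (simp add: l_def)
  have X: "X \<ge> 1" using a qs by (simp add: X_def V1_def)
  have Q: "Q \<ge> qs" by (simp add: Q_def)
  have C: "C \<ge> 0" using X Q qs e by (simp add: C_def V1_def)
  \<comment> \<open>From \<open>l * x^2 * (t - t0) \<le> C\<close> this \<open>T\<close> forces
    \<open>x^2 < \<eta>^2\<close>; the added 1 makes the inequality strict and \<open>T\<close>
    positive.\<close>
  define T where "T = C / (l * \<eta>\<^sup>2) + 1"
  have T: "T > 0" using C l by (simp add: T_def add_nonneg_pos)
  show thesis
  proof (rule that[OF T])
    fix x q :: "real \<Rightarrow> real" and t0 t :: real
    assume q0: "\<And>t. q t > 0"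
      and dx: "\<And>t. (x has_real_derivative (qs powr k - q t powr k)) (at t)"
      and dq: "\<And>t. (q has_real_derivative (a * qs * exp (x t) - a * q t)) (at t)"
      and V0: "lyap k a qs (x t0) (q t0) \<le> V0" and t: "t \<ge> t0 + T"
    define V where "V = (\<lambda>t. lyap k a qs (x t) (q t))"
    have dV: "(V has_real_derivative - a * (q t powr k - qs powr k) * (q t - qs)) (at t)" for t
      unfolding V_def using lyap_deriv[OF k(1) q0 dx dq] .
    \<comment> \<open>The product is nonnegative because it dominates the nonnegative
      potential.\<close>
    have dV0: "- a * (q t powr k - qs powr k) * (q t - qs) \<le> 0" for t
      using pot_bounds[OF k(1) qs q0[of t]] a
      by (simp add: mult.assoc)
    have V1: "V s \<le> V1" if "s \<ge> t0" for s
    proof -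
      have "V s \<le> V t0" by (rule DERIV_nonpos_imp_nonincreasing[of t0 s V, OF that]) (blast intro: dV dV0)
      then show ?thesis using V0 by (simp add: V_def V1_def)
    qed
    have Vn: "0 \<le> a * qs * (exp (x s) - 1 - x s)" "0 \<le> pot k qs (q s)" for s
      using exp_convex_bounds(1)[of "x s"] pot_bounds(1)[OF k(1) qs q0] a qs by auto
    have bx: "\<bar>x s\<bar> \<le> X" if "s \<ge> t0" for s
    proof -
      have "a * qs * (exp (x s) - 1 - x s) \<le> V1"
        using V1[OF that] Vn[of s] by (simp add: V_def lyap_def)
      then have "exp (x s) - 1 - x s \<le> V1 / (a * qs)"
        using a qs by (simp add: pos_le_divide_eq mult.commute)
      then show ?thesis using exp_convex_bounds(3)[of "x s"] by (simp add: X_def)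
    qed
    have bq: "q s \<le> Q" if "s \<ge> t0" for s
    proof -
      have "pot k qs (q s) \<le> V1"
        using V1[OF that] Vn[of s] by (simp add: V_def lyap_def)
      from pot_coercive[OF k(1) qs q0 this] show ?thesis by (simp add: Q_def)
    qed
    have bxv: "\<bar>x s * (q s - qs)\<bar> \<le> X * Q" if "s \<ge> t0" for s
      unfolding abs_mult using bx[OF that] bq[OF that] q0[of s] Q qs X
      by (intro mult_mono) auto
    \<comment> \<open>The cross term makes the dissipation definite; the last term turns
      monotonicity of \<open>F\<close> into a decay of order \<open>1 / (t - t0)\<close> of \<open>V\<close>.\<close>
    define F where "F = (\<lambda>t. V t - e * (x t * (q t - qs)) + e / 2 * ((t - t0) * V t))"
    have "F t \<le> F t0"
    proof (rule DERIV_nonpos_imp_nonincreasing[of t0 t F])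
      show "t0 \<le> t" using t T by simp
      fix s assume s: "t0 \<le> s" "s \<le> t"
      let ?d = "- a * (q s powr k - qs powr k) * (q s - qs)"
      let ?D = "?d - e * ((qs powr k - q s powr k) * (q s - qs) + x s * (a * qs * exp (x s) - a * q s))
          + e / 2 * (V s + (s - t0) * ?d)"
      have "((\<lambda>t. q t - qs) has_real_derivative a * qs * exp (x s) - a * q s) (at s)"
        using DERIV_diff[OF dq DERIV_const] by simp
      note 1 = DERIV_mult[OF dx this]
      have "((\<lambda>t. t - t0) has_real_derivative 1) (at s)"
        using DERIV_diff[OF DERIV_ident DERIV_const] by simp
      note 2 = DERIV_mult[OF this dV]
      have "(F has_real_derivative ?D) (at s)"
        using DERIV_add[OF DERIV_diff[OF dV DERIV_cmult[OF 1]] DERIV_cmult[OF 2]]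
        unfolding F_def by (rule DERIV_cong) (simp add: mult_ac)
      moreover have "?D \<le> 0"
      proof -
        have "?d + e * ((q s powr k - qs powr k) * (q s - qs)
            - x s * (a * qs * (exp (x s) - 1)) + a * x s * (q s - qs)) + e / 2 * V s \<le> 0"
          unfolding V_def using e(2)[OF bx[OF s(1)] q0 bq[OF s(1)]] .
        moreover have "e / 2 * ((s - t0) * ?d) \<le> 0"
          using s e(1) by (intro mult_nonneg_nonpos[OF _ mult_nonneg_nonpos[OF _ dV0]]) auto
        ultimately show ?thesis by (simp add: algebra_simps)
      qed
      ultimately show "\<exists>y. (F has_real_derivative y) (at s) \<and> y \<le> 0" by blast
    qed
    then have "e / 2 * ((t - t0) * V t) \<le> V t0 - V t + e * (x t * (q t - qs)) - e * (x t0 * (q t0 - qs))"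
      by (simp add: F_def)
    also have "\<dots> \<le> V1 + e * (X * Q) + e * (X * Q)"
    proof -
      have "e * (x t * (q t - qs)) \<le> e * (X * Q)" "- (e * (x t0 * (q t0 - qs))) \<le> e * (X * Q)"
        using bxv[of t] bxv[of t0] t T e(1)
        by (auto simp flip: mult_minus_right intro!: mult_left_mono simp: abs_le_iff)
      moreover have "V t0 \<le> V1" "0 \<le> V t"
        using V1[of t0] Vn[of t] by (auto simp: V_def lyap_def)
      ultimately show ?thesis by linarith
    qed
    finally have F: "e / 2 * ((t - t0) * V t) \<le> C" by (simp add: C_def algebra_simps)
    have "a * qs * (exp (- X) / 2 * (x t)\<^sup>2) \<le> a * qs * (exp (x t) - 1 - x t)"
      using exp_lower_bounds(2)[OF bx[of t]] t T a qs by (intro mult_left_mono) auto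
    also have "\<dots> \<le> V t" using Vn[of t] by (simp add: V_def lyap_def)
    finally have "e / 2 * ((t - t0) * (a * qs * (exp (- X) / 2 * (x t)\<^sup>2))) \<le> e / 2 * ((t - t0) * V t)"
      using e(1) t T by (intro mult_left_mono) auto
    also note F
    finally have "e / 2 * ((t - t0) * (a * qs * (exp (- X) / 2 * (x t)\<^sup>2))) \<le> C" .
    then have "l * (x t)\<^sup>2 * (t - t0) \<le> C" by (simp add: l_def algebra_simps)
    moreover have "l * (x t)\<^sup>2 * T \<le> l * (x t)\<^sup>2 * (t - t0)"
      using t l by (intro mult_left_mono) auto
    ultimately have le: "l * (x t)\<^sup>2 * T \<le> C" by linarith
    have "C < l * \<eta>\<^sup>2 * T" using l \<eta> by (simp add: T_def field_simps)
    with le have "l * (x t)\<^sup>2 * T < l * \<eta>\<^sup>2 * T" by linarith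
    then have "(x t)\<^sup>2 < \<eta>\<^sup>2" using l T by simp
    then show "\<bar>x t\<bar> < \<eta>" using power2_less_imp_less[of "\<bar>x t\<bar>" \<eta>] \<eta> by simp
  qed
qed

section \<open>Regular solutions in logarithmic time\<close>

lemma continuous_on_flux:
  assumes "\<alpha> > 0" "\<beta> > -1" "continuous_on {0..} v'"
  shows "continuous_on {0..} (\<lambda>r. flux \<alpha> \<beta> r (v' r))"
proof -
  \<comment> \<open>\<open>|d| powr \<beta>\<close> may fail to be continuous at 0 (for instance
    \<open>0 powr 0 = 0\<close>). Splitting \<open>d\<close> into positive and negative parts leaves
    only the positive exponent \<open>\<beta> + 1\<close>.\<close>
  have "flux \<alpha> \<beta> r d = r powr \<alpha> * (max d 0 powr (\<beta> + 1) - max (- d) 0 powr (\<beta> + 1))" for r d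
    by (cases "d > 0"; cases "d = 0") (auto simp: flux_def powr_add max_def)
  then show ?thesis
    using assms by (auto intro!: continuous_intros continuous_on_powr')
qed

locale regular_solution =
  fixes \<alpha> \<beta> \<gamma> \<rho> :: real and w w' :: "real \<Rightarrow> real"
  assumes ab: "\<alpha> > \<beta> + 1" and b: "\<beta> \<ge> 0" and th: "\<gamma> + 2 + \<beta> - \<alpha> > 0"
    and dw: "\<And>r. r \<ge> 0 \<Longrightarrow> (w has_real_derivative w' r) (at r within {0..})"
    and cont': "continuous_on {0..} w'"
    and w0: "w 0 = \<rho>"
    and dflux: "\<And>r. r > 0 \<Longrightarrow> ((\<lambda>s. flux \<alpha> \<beta> s (w' s)) has_real_derivative
                     (- (r powr \<gamma>) * exp (w r))) (at r)"
begin

definition \<theta> where "\<theta> = \<gamma> + 2 + \<beta> - \<alpha>"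
definition a where "a = \<alpha> - \<beta> - 1"
definition k where "k = 1 / (\<beta> + 1)"
definition H where "H r = - flux \<alpha> \<beta> r (w' r)"
text \<open>Defined through the flux rather than as a power of \<open>- r * w'\<close>, so that it
  is differentiable by the equation itself, with no second derivative of \<open>w\<close>.\<close>

definition q where "q t = exp (- a * t) * H (exp t)"

lemma pos: "\<theta> > 0" "a > 0" "0 < k" "k \<le> 1" "\<gamma> + 1 > 0"
  using ab b th by (auto simp: \<theta>_def a_def k_def)

lemma dw_at: "(w has_real_derivative w' r) (at r)" if "r > 0"
proof -
  have "at r within {0..} = at r" using that by (intro at_within_interior) auto
  then show ?thesis using dw[of r] that by simp
qed

lemma cont_w: "continuous_on {x..y} w" if "x \<ge> 0"
  using that dw
  by (intro continuous_on_subset[of "{0..}" w "{x..y}"] DERIV_continuous_on) auto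

lemma cont_H: "continuous_on {x..y} H" if "x \<ge> 0"
  unfolding H_def using continuous_on_flux[OF _ _ cont'] ab b that
  by (intro continuous_on_subset[of "{0..}" _ "{x..y}"] continuous_on_minus) auto

lemma dH: "(H has_real_derivative r powr \<gamma> * exp (w r)) (at r)" if "r > 0"
  using DERIV_minus[OF dflux[OF that]] unfolding H_def by simp

lemma H0: "H 0 = 0"
  by (simp add: H_def flux_def)

lemma H_pos: "H r > 0" if "r > 0"
  using DERIV_pos_imp_increasing_open[of 0 r H] that H0 cont_H dH
  by (metis exp_gt_zero mult_pos_pos order_refl powr_gt_zero less_numeral_extra(3))

lemma w'_neg: "w' r < 0" if "r > 0"
proof (rule ccontr)
  assume "\<not> w' r < 0"
  then have "H r \<le> 0" by (simp add: H_def flux_def)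
  then show False using H_pos[OF that] by simp
qed

lemma w_decreasing: "w y < w x" if "0 \<le> x" "x < y"
proof (rule DERIV_neg_imp_decreasing_open[of x y w])
  fix z assume "x < z" "z < y"
  then have "z > 0" using that by simp
  then show "\<exists>d. (w has_real_derivative d) (at z) \<and> d < 0" using dw_at w'_neg by blast
qed (use that cont_w in auto)

lemma w_le: "w r \<le> \<rho>" if "r \<ge> 0"
  using w_decreasing[of 0 r] w0 that by (cases "r = 0") auto

text \<open>Integrates \<open>H' = r powr \<gamma> * exp (w r)\<close> from \<open>H 0 = 0\<close>,
  using \<open>w \<le> \<rho>\<close>.\<close>

lemma H_le: "H r \<le> exp \<rho> * r powr (\<gamma> + 1) / (\<gamma> + 1)" if "r > 0"
proof -
  define D where "D r = exp \<rho> * (r powr (\<gamma> + 1) / (\<gamma> + 1)) - H r" for r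
  have "D 0 \<le> D r"
  proof (rule DERIV_nonneg_imp_increasing_open[of 0 r D])
    fix x assume x: "0 < x" "x < r"
    have "((\<lambda>x. x powr (\<gamma> + 1)) has_real_derivative (\<gamma> + 1) * x powr \<gamma>) (at x)"
      using has_real_derivative_powr[OF x(1), of "\<gamma> + 1"] by simp
    then have "((\<lambda>x. x powr (\<gamma> + 1) / (\<gamma> + 1)) has_real_derivative x powr \<gamma>) (at x)"
      using pos(5) by (auto dest: DERIV_cdivide[where c = "\<gamma> + 1"])
    from DERIV_diff[OF DERIV_cmult[OF this] dH[OF x(1)]]
    have "(D has_real_derivative exp \<rho> * x powr \<gamma> - x powr \<gamma> * exp (w x)) (at x)"
      unfolding D_def .
    moreover have "exp \<rho> * x powr \<gamma> - x powr \<gamma> * exp (w x) \<ge> 0"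
      using w_le[of x] x by (simp add: mult.commute mult_left_mono)
    ultimately show "\<exists>y. (D has_real_derivative y) (at x) \<and> y \<ge> 0" by blast
  next
    show "continuous_on {0..r} D"
      unfolding D_def using pos(5) cont_H[of 0 r]
      by (auto intro!: continuous_intros continuous_on_powr')
  qed (use that in auto)
  then show ?thesis using H0 by (simp add: D_def)
qed

lemma q_pos: "q t > 0"
  using H_pos by (simp add: q_def)

text \<open>Since \<open>\<alpha> - a = \<beta> + 1\<close>, the weight and the power of
  \<open>- w'\<close> merge into one power, which the exponent \<open>k\<close> undoes.\<close>

lemma q_powr: "q t powr k = - (exp t * w' (exp t))"
proof -
  define p where "p = - w' (exp t)"
  have p: "p > 0" using w'_neg[of "exp t"] by (simp add: p_def)
  have "H (exp t) = exp t powr \<alpha> * p powr (\<beta> + 1)"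
    using p w'_neg[of "exp t"] by (simp add: H_def flux_def p_def powr_add)
  then have "q t = exp (- a * t) * exp (\<alpha> * t) * p powr (\<beta> + 1)"
    by (simp add: q_def powr_def)
  also have "exp (- a * t) * exp (\<alpha> * t) = exp t powr (\<beta> + 1)"
    by (simp add: a_def powr_def flip: exp_add) (simp add: algebra_simps)
  also have "\<dots> * p powr (\<beta> + 1) = (exp t * p) powr (\<beta> + 1)"
    using p by (simp add: powr_mult)
  finally have "q t powr k = exp t * p" using p b by (simp add: powr_powr k_def)
  then show ?thesis by (simp add: p_def)
qed

text \<open>The powers of \<open>exp t\<close> collect to
  \<open>\<gamma> + 1 - a = \<theta>\<close>, which is what makes the system autonomous in
  \<open>w + \<theta> * t\<close> and \<open>q\<close>.\<close>

lemma dq: "(q has_real_derivative exp (w (exp t) + \<theta> * t) - a * q t) (at t)"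
proof -
  have e: "((\<lambda>t. exp (- a * t)) has_real_derivative exp (- a * t) * (- a)) (at t)"
    by (auto intro!: derivative_eq_intros)
  have "((\<lambda>t. H (exp t)) has_real_derivative (exp t powr \<gamma> * exp (w (exp t))) * exp t) (at t)"
    using DERIV_chain2[OF dH DERIV_exp] by simp
  from DERIV_mult[OF e this] show ?thesis
    unfolding q_def
    by (rule DERIV_cong)
      (simp add: powr_def a_def \<theta>_def algebra_simps flip: exp_add)
qed

lemma dy: "((\<lambda>t. w (exp t) + \<theta> * t - c) has_real_derivative \<theta> - q t powr k) (at t)"
proof -
  have 1: "((\<lambda>t. w (exp t)) has_real_derivative w' (exp t) * exp t) (at t)"
    using DERIV_chain2[OF dw_at DERIV_exp] by simp
  show ?thesis unfolding q_powr
    by (rule DERIV_cong[OF DERIV_diff[OF DERIV_add[OF 1 DERIV_cmult[OF DERIV_ident]] DERIV_const]])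
      simp
qed

lemma q_le: "q t \<le> exp (\<rho> + \<theta> * t) / (\<gamma> + 1)"
proof -
  have "q t \<le> exp (- a * t) * (exp \<rho> * exp t powr (\<gamma> + 1) / (\<gamma> + 1))"
    unfolding q_def using H_le[of "exp t"] by (intro mult_left_mono) auto
  also have "\<dots> = exp (\<rho> + \<theta> * t) / (\<gamma> + 1)"
    by (simp add: powr_def a_def \<theta>_def algebra_simps flip: exp_add)
  finally show ?thesis .
qed

text \<open>The constant obtained by raising \<open>q_le\<close> to the power
  \<open>k\<close>.\<close>

definition \<kappa> where "\<kappa> = (1 / (\<gamma> + 1)) powr k"

text \<open>Integrates \<open>- r * w' = q powr k \<le> \<kappa> * exp (k * \<rho>) * r powr (k *
  \<theta>)\<close> from the origin; \<open>E\<close> is \<open>w\<close> plus the primitive of the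
  resulting bound on \<open>- w'\<close>.\<close>

lemma w_ge: "\<rho> - \<kappa> / (k * \<theta>) * exp (k * (\<rho> + \<theta> * t)) \<le> w (exp t)"
proof -
  define E where "E r = w r + \<kappa> / (k * \<theta>) * exp (k * \<rho>) * r powr (k * \<theta>)" for r
  have k\<theta>: "k * \<theta> > 0" using pos by simp
  have "E 0 \<le> E (exp t)"
  proof (rule DERIV_nonneg_imp_increasing_open[of 0 "exp t" E])
    fix x :: real assume x: "0 < x" "x < exp t"
    have "(E has_real_derivative w' x + \<kappa> / (k * \<theta>) * exp (k * \<rho>) * ((k * \<theta>) * x powr (k * \<theta> - 1))) (at x)"
      unfolding E_def
      by (intro DERIV_add DERIV_cmult dw_at has_real_derivative_powr x)
    moreover have "w' x + \<kappa> / (k * \<theta>) * exp (k * \<rho>) * ((k * \<theta>) * x powr (k * \<theta> - 1)) \<ge> 0"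
    proof -
      have "- (x * w' x) = q (ln x) powr k" using q_powr[of "ln x"] x by simp
      also have "\<dots> \<le> (exp (\<rho> + \<theta> * ln x) / (\<gamma> + 1)) powr k"
        using q_le q_pos pos by (intro powr_mono2) (auto intro: less_imp_le)
      also have "\<dots> = \<kappa> * exp (\<rho> + \<theta> * ln x) powr k"
        using pos by (simp add: \<kappa>_def powr_divide)
      also have "exp (\<rho> + \<theta> * ln x) powr k = exp (k * \<rho>) * x powr (k * \<theta>)"
        using x by (simp add: powr_def algebra_simps flip: exp_add)
      also have "x powr (k * \<theta>) = x * x powr (k * \<theta> - 1)"
        using x by (simp add: powr_diff)
      finally have "x * (w' x + \<kappa> * exp (k * \<rho>) * x powr (k * \<theta> - 1)) \<ge> 0"
        by (simp add: algebra_simps)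
      then show ?thesis using x pos by (simp add: zero_le_mult_iff)
    qed
    ultimately show "\<exists>y. (E has_real_derivative y) (at x) \<and> y \<ge> 0" by blast
  next
    show "continuous_on {0..exp t} E"
      unfolding E_def using k\<theta> cont_w[of 0 "exp t"]
      by (auto intro!: continuous_intros continuous_on_powr')
  qed auto
  moreover have "exp (k * \<rho>) * exp t powr (k * \<theta>) = exp (k * (\<rho> + \<theta> * t))"
    by (simp add: powr_def algebra_simps flip: exp_add)
  ultimately show ?thesis using w0 by (simp add: E_def mult.assoc)
qed

text \<open>At the time \<open>t0\<close>, where \<open>\<rho> + \<theta> * t0 = 0\<close>, the bound does not depend on \<open>\<rho>\<close>.\<close>
lemma initial_lyap:
  defines "l \<equiv> a * \<theta> powr (\<beta> + 1)" and "t0 \<equiv> - \<rho> / \<theta>"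
  shows "lyap k a (\<theta> powr (\<beta> + 1)) (w (exp t0) + \<theta> * t0 - ln l) (q t0)
    \<le> l * (1 / l - 1 + \<kappa> / (k * \<theta>) + ln l) + (\<kappa> / (\<gamma> + 1) + \<theta> * \<theta> powr (\<beta> + 1))"
proof -
  define x where "x = w (exp t0) + \<theta> * t0 - ln l"
  define qs where "qs = \<theta> powr (\<beta> + 1)"
  have l: "l > 0" using pos by (simp add: l_def)
  have t0: "\<theta> * t0 = - \<rho>" using pos by (simp add: t0_def)
  have qs: "qs > 0" "qs powr k = \<theta>" using pos b by (auto simp: qs_def k_def powr_powr)
  \<comment> \<open>\<open>w \<le> \<rho>\<close> bounds \<open>exp x\<close> and
    \<open>w_ge\<close> bounds \<open>- x\<close>; in both, \<open>\<rho>\<close> cancels against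
    \<open>\<theta> * t0\<close>.\<close>
  have "exp x \<le> exp (- ln l)" using w_le[of "exp t0"] t0 by (simp add: x_def)
  also have "\<dots> = 1 / l" using l by (simp add: exp_minus inverse_eq_divide)
  finally have 1: "exp x \<le> 1 / l" .
  have 2: "- x \<le> \<kappa> / (k * \<theta>) + ln l"
    using w_ge[of t0] t0 by (simp add: x_def)
  have A: "l * (exp x - 1 - x) \<le> l * (1 / l - 1 + \<kappa> / (k * \<theta>) + ln l)"
    using 1 2 l by (intro mult_left_mono) auto
  have q1: "q t0 \<le> 1 / (\<gamma> + 1)" using q_le[of t0] t0 by simp
  then have q2: "q t0 powr k \<le> \<kappa>"
    unfolding \<kappa>_def using q_pos[of t0] pos by (intro powr_mono2) auto
  have "pot k qs (q t0) \<le> (q t0 powr k - \<theta>) * (q t0 - qs)"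
    using pot_bounds(2)[OF pos(3) qs(1) q_pos[of t0]] qs(2) by simp
  also have "\<dots> \<le> q t0 powr k * q t0 + \<theta> * qs"
    using qs(1) pos q_pos[of t0] by (simp add: algebra_simps add_nonneg_nonneg)
  also have "\<dots> \<le> \<kappa> * (1 / (\<gamma> + 1)) + \<theta> * qs"
    using q1 q2 q_pos[of t0] qs(1) pos by (intro add_mono mult_mono) (auto simp: \<kappa>_def)
  finally show ?thesis using A
    by (simp add: lyap_def x_def qs_def l_def)
qed

end

section \<open>Uniform asymptotics for large initial values\<close>

lemma regular_solutionI:
  assumes "\<alpha> > \<beta> + 1" "\<beta> \<ge> 0" "\<gamma> + 2 + \<beta> - \<alpha> > 0" "is_regular_sol \<alpha> \<beta> \<gamma> \<rho> w"
  obtains w' where "regular_solution \<alpha> \<beta> \<gamma> \<rho> w w'"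
  using assms unfolding is_regular_sol_def regular_solution_def by blast

lemma regular_sol_uniform_asymptotics:
  fixes \<alpha> \<beta> \<gamma> \<theta> \<eta> c :: real
  assumes ab: "\<alpha> > \<beta> + 1" and b: "\<beta> \<ge> 0" and th: "\<theta> = \<gamma> + 2 + \<beta> - \<alpha>" "\<theta> > 0"
    and "\<eta> > 0" "c > 0"
  obtains \<rho>0 where "\<And>\<rho> w r. \<lbrakk>\<rho> \<ge> \<rho>0; is_regular_sol \<alpha> \<beta> \<gamma> \<rho> w; r \<ge> c\<rbrakk> \<Longrightarrow>
      \<bar>w r + \<theta> * ln r - ln (\<theta> powr (\<beta> + 1) * (\<alpha> - \<beta> - 1))\<bar> < \<eta>"
proof -
  define a where "a = \<alpha> - \<beta> - 1"
  define k where "k = 1 / (\<beta> + 1)"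
  define qs where "qs = \<theta> powr (\<beta> + 1)"
  define \<kappa> where "\<kappa> = (1 / (\<gamma> + 1)) powr k"
  define l where "l = a * qs"
  define V0 where "V0 = l * (1 / l - 1 + \<kappa> / (k * \<theta>) + ln l) + (\<kappa> / (\<gamma> + 1) + \<theta> * qs)"
  have pos: "a > 0" "0 < k" "k \<le> 1" "qs > 0" "qs powr k = \<theta>"
    using assms by (auto simp: a_def k_def qs_def powr_powr)
  have l: "l > 0" using pos by (simp add: l_def)
  obtain T where T: "T > 0" "\<And>x q t0 t. \<lbrakk>\<And>t. q t > 0;
       \<And>t. (x has_real_derivative (qs powr k - q t powr k)) (at t);
       \<And>t. (q has_real_derivative (a * qs * exp (x t) - a * q t)) (at t);
       lyap k a qs (x t0) (q t0) \<le> V0; t \<ge> t0 + T\<rbrakk> \<Longrightarrow> \<bar>x t\<bar> < \<eta>"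
    using emden_fowler_uniform_convergence[OF pos(2,3,1,4) \<open>\<eta> > 0\<close>, of V0] by blast
  show thesis
  \<comment> \<open>This threshold is exactly the condition
    \<open>- \<rho> / \<theta> + T \<le> ln c\<close>: the fixed waiting time has elapsed before
    \<open>r = c\<close>.\<close>
  proof (rule that[of "\<theta> * (T - ln c)"])
    fix \<rho> r :: real and w :: "real \<Rightarrow> real"
    assume \<rho>: "\<rho> \<ge> \<theta> * (T - ln c)" and sol: "is_regular_sol \<alpha> \<beta> \<gamma> \<rho> w" and r: "r \<ge> c"
    obtain w' where "regular_solution \<alpha> \<beta> \<gamma> \<rho> w w'"
      using regular_solutionI[OF ab b _ sol] th by auto
    then interpret S: regular_solution \<alpha> \<beta> \<gamma> \<rho> w w' .
    have eq: "S.\<theta> = \<theta>" "S.a = a" "S.k = k" "S.\<kappa> = \<kappa>"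
      using th by (simp_all add: S.\<theta>_def S.a_def S.k_def S.\<kappa>_def a_def k_def \<kappa>_def)
    let ?x = "\<lambda>t. w (exp t) + \<theta> * t - ln l"
    have "\<bar>?x (ln r)\<bar> < \<eta>"
    proof (rule T(2)[of S.q ?x "- \<rho> / \<theta>"])
      show "S.q t > 0" for t by (rule S.q_pos)
      show "(?x has_real_derivative qs powr k - S.q t powr k) (at t)" for t
        using S.dy[of "ln l" t] by (simp add: eq pos)
      show "(S.q has_real_derivative a * qs * exp (?x t) - a * S.q t) (at t)" for t
        using S.dq[of t] l by (simp add: eq exp_diff flip: l_def)
      show "lyap k a qs (?x (- \<rho> / \<theta>)) (S.q (- \<rho> / \<theta>)) \<le> V0"
        using S.initial_lyap unfolding eq V0_def l_def qs_def .
      have "T - ln c \<le> \<rho> / \<theta>" using \<rho> th(2) by (simp add: pos_le_divide_eq mult.commute)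
      moreover have "ln c \<le> ln r" using r \<open>c > 0\<close> by simp
      ultimately show "- \<rho> / \<theta> + T \<le> ln r" by simp
    qed
    then show "\<bar>w r + \<theta> * ln r - ln (\<theta> powr (\<beta> + 1) * (\<alpha> - \<beta> - 1))\<bar> < \<eta>"
      using r \<open>c > 0\<close> by (simp add: l_def a_def qs_def mult.commute)
  qed
qed

section \<open>Limits of the solutions, of their zeros and of the rescaled solutions\<close>

lemma regular_sol_strict_decreasing:
  assumes "\<alpha> > \<beta> + 1" "\<beta> \<ge> 0" "\<gamma> + 2 + \<beta> - \<alpha> > 0" "is_regular_sol \<alpha> \<beta> \<gamma> \<rho> w"
    and "0 \<le> r" "r < s"
  shows "w s < w r"
  using regular_solutionI[OF assms(1-4)] regular_solution.w_decreasing assms(5,6) by metis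

lemma compact_pos_lower_bound:
  fixes K :: "real set"
  assumes "compact K" "K \<subseteq> {0<..}"
  obtains c where "c > 0" "\<And>r. r \<in> K \<Longrightarrow> c \<le> r"
proof (cases "K = {}")
  case True
  then show ?thesis using that[of 1] by simp
next
  case False
  then obtain c where "c \<in> K" "\<forall>r\<in>K. c \<le> r"
    using compact_attains_inf[OF assms(1)] by blast
  then show ?thesis using that[of c] assms(2) by auto
qed

theorem theorem1p8:
  fixes \<alpha> \<beta> \<gamma> \<theta> :: real
    and u :: "real \<Rightarrow> real \<Rightarrow> real"  (* u r \<rho> = u(r,\<rho>) *)
    and R :: "real \<Rightarrow> real"
  assumes "\<alpha> > \<beta> + 1" and "\<beta> \<ge> 0"
    and "\<theta> = \<gamma> + 2 + \<beta> - \<alpha>" and "\<theta> > 0"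
    and sol: "\<forall>\<rho>>0. is_regular_sol \<alpha> \<beta> \<gamma> \<rho> (\<lambda>r. u r \<rho>)"
    and zero: "\<forall>\<rho>>0. R \<rho> > 0 \<and> u (R \<rho>) \<rho> = 0 \<and> (\<forall>r>0. u r \<rho> = 0 \<longrightarrow> r = R \<rho>)"
  shows "(\<forall>K. compact K \<and> K \<subseteq> {0<..} \<longrightarrow>
            uniform_limit K (\<lambda>\<rho> r. u r \<rho>)
              (\<lambda>r. ln (\<theta> powr (\<beta> + 1) * (\<alpha> - \<beta> - 1)) - \<theta> * ln r) at_top)
      \<and> ((\<lambda>\<rho>. R \<rho> powr \<theta>) \<longlongrightarrow> \<theta> powr (\<beta> + 1) * (\<alpha> - \<beta> - 1)) at_top
      \<and> (\<forall>K. compact K \<and> K \<subseteq> {0<..} \<longrightarrow>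
            uniform_limit K (\<lambda>\<rho> r. u ((R \<rho> powr \<theta>) powr (1 / \<theta>) * r) \<rho>)
              (\<lambda>r. - \<theta> * ln r) at_top)"
proof -
  define l where "l = \<theta> powr (\<beta> + 1) * (\<alpha> - \<beta> - 1)"
  have l: "l > 0" using assms(1,4) by (simp add: l_def)
  have asym: "\<forall>\<^sub>F \<rho> in at_top. \<rho> > 0 \<and> (\<forall>r\<ge>c. \<bar>u r \<rho> + \<theta> * ln r - ln l\<bar> < \<eta>)"
    if pos: "\<eta> > 0" "c > 0" for \<eta> c :: real
  proof -
    obtain \<rho>0 where *: "\<And>\<rho> w r. \<lbrakk>\<rho> \<ge> \<rho>0; is_regular_sol \<alpha> \<beta> \<gamma> \<rho> w; r \<ge> c\<rbrakk> \<Longrightarrow>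
      \<bar>w r + \<theta> * ln r - ln l\<bar> < \<eta>"
      using regular_sol_uniform_asymptotics[OF assms(1-4) pos] unfolding l_def by blast
    show ?thesis
      using eventually_ge_at_top[of \<rho>0] eventually_gt_at_top[of 0]
      by eventually_elim (use sol * in auto)
  qed
  \<comment> \<open>The singular solution equals 1 at \<open>c0\<close>.\<close>
  define c0 where "c0 = exp ((ln l - 1) / \<theta>)"
  \<comment> \<open>The asymptotics hold only away from 0, so evaluating them at
    \<open>R \<rho>\<close> needs a lower bound free of \<open>\<rho>\<close>. Error below 1 at
    \<open>c0\<close> gives \<open>u c0 \<rho> > 0\<close>, and monotonicity then puts the zero to
    the right of \<open>c0\<close>.\<close>
  have R_lower: "\<forall>\<^sub>F \<rho> in at_top. \<rho> > 0 \<and> R \<rho> > c0"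
    using asym[of 1 c0]
  proof (rule eventually_mono)
    fix \<rho> assume \<rho>: "\<rho> > 0 \<and> (\<forall>r\<ge>c0. \<bar>u r \<rho> + \<theta> * ln r - ln l\<bar> < 1)"
    have "\<bar>u c0 \<rho> + (ln l - 1) - ln l\<bar> < 1"
      using \<rho>[THEN conjunct2, rule_format, of c0] assms(4) by (simp add: c0_def)
    then have "u c0 \<rho> > 0" by linarith
    moreover have "u c0 \<rho> \<le> 0" if "R \<rho> \<le> c0"
      using regular_sol_strict_decreasing[of \<beta> \<alpha> \<gamma> \<rho> "\<lambda>r. u r \<rho>" "R \<rho>" c0] assms \<rho> that zero
      by (cases "R \<rho> = c0") (force intro: less_imp_le)+
    ultimately show "\<rho> > 0 \<and> R \<rho> > c0" using \<rho> by force
  qed (auto simp: c0_def)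
  have c0: "c0 > 0" by (simp add: c0_def)
  have lnR: "((\<lambda>\<rho>. \<theta> * ln (R \<rho>)) \<longlongrightarrow> ln l) at_top"
  proof (rule tendstoI)
    fix \<eta> :: real assume "\<eta> > 0"
    from R_lower asym[OF this c0]
    show "\<forall>\<^sub>F \<rho> in at_top. dist (\<theta> * ln (R \<rho>)) (ln l) < \<eta>"
    proof eventually_elim
      case (elim \<rho>)
      then have "\<bar>u (R \<rho>) \<rho> + \<theta> * ln (R \<rho>) - ln l\<bar> < \<eta>" by simp
      then show ?case using zero elim by (simp add: dist_real_def)
    qed
  qed
  have 2: "((\<lambda>\<rho>. R \<rho> powr \<theta>) \<longlongrightarrow> l) at_top"
  proof (rule Lim_transform_eventually)
    show "((\<lambda>\<rho>. exp (\<theta> * ln (R \<rho>))) \<longlongrightarrow> l) at_top"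
      using tendsto_exp[OF lnR] l by simp
    show "\<forall>\<^sub>F \<rho> in at_top. exp (\<theta> * ln (R \<rho>)) = R \<rho> powr \<theta>"
      using eventually_gt_at_top[of 0]
    proof eventually_elim
      case (elim \<rho>)
      then have "R \<rho> > 0" using zero by blast
      then show ?case by (simp add: powr_def)
    qed
  qed
  have 1: "uniform_limit K (\<lambda>\<rho> r. u r \<rho>) (\<lambda>r. ln l - \<theta> * ln r) at_top"
    if K: "compact K" "K \<subseteq> {0<..}" for K
  proof (rule uniform_limitI)
    obtain c where c: "c > 0" "\<And>r. r \<in> K \<Longrightarrow> c \<le> r"
      using compact_pos_lower_bound[OF K] by blast
    fix \<eta> :: real assume "\<eta> > 0"
    from asym[OF this c(1)]
    show "\<forall>\<^sub>F \<rho> in at_top. \<forall>r\<in>K. dist (u r \<rho>) (ln l - \<theta> * ln r) < \<eta>"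
      by eventually_elim (use c(2) in \<open>auto simp: dist_real_def algebra_simps\<close>)
  qed
  have 3: "uniform_limit K (\<lambda>\<rho> r. u ((R \<rho> powr \<theta>) powr (1 / \<theta>) * r) \<rho>) (\<lambda>r. - \<theta> * ln r) at_top"
    if K: "compact K" "K \<subseteq> {0<..}" for K
  proof (rule uniform_limitI)
    obtain c where c: "c > 0" "\<And>r. r \<in> K \<Longrightarrow> c \<le> r"
      using compact_pos_lower_bound[OF K] by blast
    fix \<eta> :: real assume "\<eta> > 0"
    \<comment> \<open>Half of the error comes from the asymptotics at
      \<open>R \<rho> * r \<ge> c0 * c\<close>, the other half from replacing
      \<open>\<theta> * ln (R \<rho>)\<close> by its limit \<open>ln l\<close>.\<close>
    then have \<eta>: "\<eta> / 2 > 0" by simp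
    have "c0 * c > 0" using c c0 by simp
    from R_lower asym[OF \<eta> this] tendstoD[OF lnR \<eta>]
    show "\<forall>\<^sub>F \<rho> in at_top. \<forall>r\<in>K. dist (u ((R \<rho> powr \<theta>) powr (1 / \<theta>) * r) \<rho>) (- \<theta> * ln r) < \<eta>"
    proof eventually_elim
      case (elim \<rho>)
      show ?case
      proof
        fix r assume r: "r \<in> K"
        have pos: "R \<rho> > 0" "r > 0" using elim c(1) c(2)[OF r] c0 by auto
        have "c0 * c \<le> R \<rho> * r" using elim c(1) c(2)[OF r] c0 by (intro mult_mono) auto
        then have "\<bar>u (R \<rho> * r) \<rho> + \<theta> * ln (R \<rho> * r) - ln l\<bar> < \<eta> / 2" using elim by blast
        moreover have "\<theta> * ln (R \<rho> * r) = \<theta> * ln (R \<rho>) + \<theta> * ln r"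
          using pos by (simp add: ln_mult algebra_simps)
        moreover have "\<bar>\<theta> * ln (R \<rho>) - ln l\<bar> < \<eta> / 2" using elim by (simp add: dist_real_def)
        ultimately have "\<bar>u (R \<rho> * r) \<rho> + \<theta> * ln r\<bar> < \<eta>" by linarith
        moreover have "(R \<rho> powr \<theta>) powr (1 / \<theta>) = R \<rho>"
          using pos assms(4) by (simp add: powr_powr)
        ultimately show "dist (u ((R \<rho> powr \<theta>) powr (1 / \<theta>) * r) \<rho>) (- \<theta> * ln r) < \<eta>"
          by (simp add: dist_real_def)
      qed
    qed
  qed
  show ?thesis using 1 2 3 unfolding l_def by blast
qed

end
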